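(* Let $K$ be a field, let $P=K[a_0,\dots,a_n]$, let $S=K[g_1,\dots,g_r]\subseteq P$, and let $g\in S\setminus\{0\}$ be such that $S:g^\infty$ is finitely generated as a $K$-algebra. Then the following algorithm terminates after finitely many iterations and returns $S:g^\infty$. Step 1: let $S'=S$ (with its given generators). Step 2 (main loop): 2.1: call $g'_1,\dots,g'_s$ the non-constant generators of $S'$; 2.2: compute a finite set $\{H_1,\dots,H_t\}$ of generators of the ideal $\mathrm{Rel}_g(g'_1,\dots,g'_s)$; 2.3: for $j=1,\dots,t$ let $h_j=H_j(g'_1,\dots,g'_s):g^\infty$; 2.4: if $h_1,\dots,h_t\in S'$, return $S'$ and stop; 2.5: redefine $S'$ as $K[g'_1,\dots,g'_s,h_1,\dots,h_t]$ (with these generators) and repeat the loop.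
   Context: For a subalgebra $S$ of $P$ with $g\in S$, $S:g^\infty=\bigcup_{i\in\mathbb N}\{f\in P\mid g^if\in S\}$ (which equals $S[g^{-1}]\cap P$, a $K$-subalgebra of $P$). The ideal of relations $\mathrm{Rel}_g(f_1,\dots,f_s)$ of $f_1,\dots,f_s\in P$ modulo $g$ is the kernel of the composition $K[x_1,\dots,x_s]\to P\to P/\langle g\rangle$, where the first map is the $K$-algebra homomorphism with $x_i\mapsto f_i$ and the second is the canonical projection. For $f\in P$, $f:g^\infty$ is the polynomial $f/g^i$, where $g^i$ is the highest power of $g$ dividing $f$; by convention $f:g^\infty=f$ if $f=0$ or $g$ is a constant. The choice of generators of the ideals of relations in Step 2.2 is arbitrary. *)

theory Defs
  imports Complex_Main "HOL-Library.Poly_Mapping"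
begin

text \<open>
  Polynomials are finitely supported maps from exponent vectors to coefficients, in countably
  many indeterminates \<open>x 0, x 1, \<dots>\<close>. The ring \<open>K[a_0,\<dots>,a_n]\<close> is the subring
  \<open>polys_in {..n}\<close>, and \<open>K[x_1,\<dots>,x_s]\<close> is \<open>polys_in {..<s}\<close>, with \<open>x_i\<close> at index \<open>i - 1\<close>
  so that it matches position \<open>i - 1\<close> in a list of generators.
\<close>

type_synonym 'k mpoly = "(nat \<Rightarrow>\<^sub>0 nat) \<Rightarrow>\<^sub>0 'k"

definition polys_in :: "nat set \<Rightarrow> 'k::field mpoly set" where
  "polys_in V = {p. \<forall>m \<in> Poly_Mapping.keys p. Poly_Mapping.keys m \<subseteq> V}"

definition const_poly :: "'k::field \<Rightarrow> 'k mpoly" where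
  "const_poly c = Poly_Mapping.single 0 c"

definition is_const :: "'k::field mpoly \<Rightarrow> bool" where
  "is_const p \<longleftrightarrow> (\<exists>c. p = const_poly c)"

text \<open>\<open>substitute f\<close> is the \<open>K\<close>-algebra homomorphism with \<open>x i \<mapsto> f i\<close>.\<close>

definition substitute :: "(nat \<Rightarrow> 'k mpoly) \<Rightarrow> 'k::field mpoly \<Rightarrow> 'k mpoly" where
  "substitute f p = (\<Sum>m \<in> Poly_Mapping.keys p. const_poly (Poly_Mapping.lookup p m) *
     (\<Prod>i \<in> Poly_Mapping.keys m. f i ^ Poly_Mapping.lookup m i))"

definition is_subalgebra :: "'k::field mpoly set \<Rightarrow> bool" where
  "is_subalgebra A \<longleftrightarrow> (\<forall>c. const_poly c \<in> A) \<and>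
     (\<forall>p\<in>A. \<forall>q\<in>A. p + q \<in> A \<and> p * q \<in> A)"

definition alg_gen :: "'k::field mpoly set \<Rightarrow> 'k mpoly set" where
  "alg_gen F = is_subalgebra hull F"

definition finitely_generated_alg :: "'k::field mpoly set \<Rightarrow> bool" where
  "finitely_generated_alg A \<longleftrightarrow> (\<exists>F. finite F \<and> A = alg_gen F)"

definition is_ideal :: "'k::field mpoly set \<Rightarrow> 'k mpoly set \<Rightarrow> bool" where
  "is_ideal R I \<longleftrightarrow> I \<subseteq> R \<and> 0 \<in> I \<and> (\<forall>p\<in>I. \<forall>q\<in>I. p + q \<in> I) \<and> (\<forall>r\<in>R. \<forall>p\<in>I. r * p \<in> I)"

definition ideal_gen :: "'k::field mpoly set \<Rightarrow> 'k mpoly set \<Rightarrow> 'k mpoly set" where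
  "ideal_gen R F = is_ideal R hull F"

text \<open>The saturation \<open>S : g\<^sup>\<infinity>\<close> inside \<open>P = K[a_0,\<dots>,a_n]\<close>.\<close>

definition saturation :: "nat \<Rightarrow> 'k::field mpoly \<Rightarrow> 'k mpoly set \<Rightarrow> 'k mpoly set" where
  "saturation n g S = (\<Union>i::nat. {f \<in> polys_in {..n}. g ^ i * f \<in> S})"

text \<open>
  The ideal of relations: an element of \<open>K[x_1,\<dots>,x_s]\<close> is in the kernel of
  \<open>K[x_1,\<dots>,x_s] \<rightarrow> P \<rightarrow> P/\<langle>g\<rangle>\<close> iff its image in \<open>P\<close> lies in \<open>\<langle>g\<rangle>\<close>.
\<close>

definition relations_ideal :: "nat \<Rightarrow> 'k::field mpoly \<Rightarrow> 'k mpoly list \<Rightarrow> 'k mpoly set" where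
  "relations_ideal n g fs =
     {H \<in> polys_in {..<length fs}. substitute ((!) fs) H \<in> ideal_gen (polys_in {..n}) {g}}"

text \<open>
  The polynomial \<open>f : g\<^sup>\<infinity>\<close>, with divisibility taken in \<open>P = K[a_0,\<dots>,a_n]\<close>. For \<open>f \<noteq> 0\<close> and
  non-constant \<open>g\<close> the exponents are bounded by the degree of \<open>f\<close>, and the quotient is unique,
  so \<open>GREATEST\<close> and \<open>THE\<close> are well defined.
\<close>

definition divide_out :: "nat \<Rightarrow> 'k::field mpoly \<Rightarrow> 'k mpoly \<Rightarrow> 'k mpoly" where
  "divide_out n g f =
     (if f = 0 \<or> is_const g then f
      else (let i = (GREATEST i. \<exists>q \<in> polys_in {..n}. f = g ^ i * q)
            in THE q. q \<in> polys_in {..n} \<and> f = g ^ i * q))"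

text \<open>
  The current algebra \<open>S'\<close> is kept as its list of generators. Each step is one pass through the
  main loop; the finite generating set \<open>Hs\<close> of the ideal of relations is unconstrained, so the
  step relation is nondeterministic.
\<close>

datatype 'p state = Running "'p list" | Returned "'p set"

inductive loop_step :: "nat \<Rightarrow> 'k::field mpoly \<Rightarrow> 'k mpoly state \<Rightarrow> 'k mpoly state \<Rightarrow> bool"
  for n :: nat and g :: "'k mpoly"
where
  stop: "\<lbrakk>gs' = filter (\<lambda>p. \<not> is_const p) gs;
          ideal_gen (polys_in {..<length gs'}) (set Hs) = relations_ideal n g gs';
          hs = map (\<lambda>H. divide_out n g (substitute ((!) gs') H)) Hs;
          set hs \<subseteq> alg_gen (set gs)\<rbrakk>
         \<Longrightarrow> loop_step n g (Running gs) (Returned (alg_gen (set gs)))"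
| continue: "\<lbrakk>gs' = filter (\<lambda>p. \<not> is_const p) gs;
          ideal_gen (polys_in {..<length gs'}) (set Hs) = relations_ideal n g gs';
          hs = map (\<lambda>H. divide_out n g (substitute ((!) gs') H)) Hs;
          \<not> set hs \<subseteq> alg_gen (set gs)\<rbrakk>
         \<Longrightarrow> loop_step n g (Running gs) (Running (gs' @ hs))"

end

theory Submission
  imports Defs
begin

text \<open>
  Write \<open>P = K[a_0,\<dots>,a_n]\<close>. Throughout a run the current algebra \<open>S'\<close> lies between \<open>S\<close> and
  \<open>S : g\<^sup>\<infinity>\<close>: the saturation is an algebra, and it is closed under dividing out powers of \<open>g\<close>.

  The core is \<open>divide_once\<close>: if \<open>f \<in> P\<close> and \<open>g f \<in> S'\<close>, then \<open>f\<close> lies in the algebra generated by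
  \<open>S'\<close> and \<open>h_1,\<dots>,h_t\<close>. Indeed \<open>g f = H(g')\<close> for some relation \<open>H = \<Sum> A_j H_j\<close> modulo \<open>g\<close>, and
  since \<open>H_j(g')\<close> is divisible by \<open>g\<close>, it equals \<open>g\<close> times \<open>g^(k_j - 1) h_j\<close> with \<open>k_j \<ge> 1\<close>
  (or it is \<open>0\<close>, or \<open>g\<close> is a unit); now cancel \<open>g\<close>.

  Correctness follows because at a stop all \<open>h_j\<close> lie in \<open>S'\<close>, so \<open>S'\<close> is closed under
  division by \<open>g\<close>. Termination follows because, if \<open>F\<close> is a finite set of generators of the saturation
  and \<open>g^N F \<subseteq> S\<close>, then \<open>N\<close> iterations place \<open>F\<close> inside \<open>S'\<close>; from then on \<open>S'\<close> is the whole saturation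
  and contains all \<open>h_j\<close>.

  Every pass can be carried out because the ideal of relations is finitely generated. This is
  Hilbert's basis theorem, obtained from Dickson's lemma and leading monomials. Leading monomials
  also bound the power of a non-constant \<open>g\<close> dividing a nonzero polynomial, which makes
  \<open>f : g\<^sup>\<infinity>\<close> meaningful.
\<close>

section \<open>Polynomials and subalgebras\<close>

text \<open>The value of the monomial with exponent vector \<open>m\<close> at \<open>x i = f i\<close>.\<close>

abbreviation monom_value :: "(nat \<Rightarrow> 'k::field mpoly) \<Rightarrow> (nat \<Rightarrow>\<^sub>0 nat) \<Rightarrow> 'k mpoly" where
  "monom_value f m \<equiv> (\<Prod>i \<in> Poly_Mapping.keys m. f i ^ Poly_Mapping.lookup m i)"

lemma const_poly_0 [simp]: "const_poly 0 = 0"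
  and const_poly_1 [simp]: "const_poly 1 = 1"
  and const_poly_add: "const_poly (c + d) = const_poly c + const_poly d"
  and const_poly_mult: "const_poly (c * d) = const_poly c * const_poly d"
  by (simp_all add: const_poly_def single_add mult_single)

lemma keys_add_nat:
  fixes a b :: "'a \<Rightarrow>\<^sub>0 nat"
  shows "Poly_Mapping.keys (a + b) = Poly_Mapping.keys a \<union> Poly_Mapping.keys b"
  by (auto simp: in_keys_iff lookup_add)

lemma is_subalgebra_polys_in: "is_subalgebra (polys_in V :: 'k::field mpoly set)"
  unfolding is_subalgebra_def
proof (intro conjI allI ballI)
  show "const_poly c \<in> polys_in V" for c
    by (simp add: polys_in_def const_poly_def)
next
  fix p q :: "'k mpoly" assume pq: "p \<in> polys_in V" "q \<in> polys_in V"
  show "p + q \<in> polys_in V"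
    using pq Poly_Mapping.keys_add[of p q] by (auto simp: polys_in_def)
  show "p * q \<in> polys_in V"
    unfolding polys_in_def
  proof (intro CollectI ballI)
    fix m assume "m \<in> Poly_Mapping.keys (p * q)"
    then obtain a b where "m = a + b" "a \<in> Poly_Mapping.keys p" "b \<in> Poly_Mapping.keys q"
      using keys_mult[of p q] by blast
    then show "Poly_Mapping.keys m \<subseteq> V"
      using pq by (simp add: keys_add_nat polys_in_def)
  qed
qed

context
  fixes A :: "'k::field mpoly set"
  assumes A: "is_subalgebra A"
begin

lemma subalgebra_const: "const_poly c \<in> A"
  using A by (simp add: is_subalgebra_def)

lemma subalgebra_0: "0 \<in> A"
  using subalgebra_const[of 0] by simp

lemma subalgebra_1: "1 \<in> A"
  using subalgebra_const[of 1] by simp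

lemma subalgebra_add: "p \<in> A \<Longrightarrow> q \<in> A \<Longrightarrow> p + q \<in> A"
  and subalgebra_mult: "p \<in> A \<Longrightarrow> q \<in> A \<Longrightarrow> p * q \<in> A"
  using A by (simp_all add: is_subalgebra_def)

lemma subalgebra_power: "p \<in> A \<Longrightarrow> p ^ i \<in> A"
  by (induction i) (simp_all add: subalgebra_1 subalgebra_mult)

lemma subalgebra_sum: "(\<And>i. i \<in> I \<Longrightarrow> f i \<in> A) \<Longrightarrow> sum f I \<in> A"
  by (induction I rule: infinite_finite_induct) (simp_all add: subalgebra_0 subalgebra_add)

lemma subalgebra_prod: "(\<And>i. i \<in> I \<Longrightarrow> f i \<in> A) \<Longrightarrow> prod f I \<in> A"
  by (induction I rule: infinite_finite_induct) (simp_all add: subalgebra_1 subalgebra_mult)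

lemma subalgebra_substitute:
  assumes "p \<in> polys_in V" "\<And>i. i \<in> V \<Longrightarrow> f i \<in> A"
  shows "substitute f p \<in> A"
  unfolding substitute_def
  using assms
  by (intro subalgebra_sum subalgebra_mult subalgebra_const subalgebra_prod subalgebra_power)
     (auto simp: polys_in_def)

lemma subalgebra_multiples_0: "0 \<in> (*) g ` A"
  using subalgebra_0 by (auto intro!: image_eqI[where x = 0])

lemma subalgebra_multiples_add:
  "p \<in> (*) g ` A \<Longrightarrow> q \<in> (*) g ` A \<Longrightarrow> p + q \<in> (*) g ` A"
  by (auto intro!: imageI subalgebra_add simp flip: distrib_left)

lemma subalgebra_multiples_mult:
  assumes "r \<in> A" "p \<in> (*) g ` A"
  shows "r * p \<in> (*) g ` A"
proof -
  obtain a where a: "a \<in> A" "p = g * a" using assms(2) by blast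
  then have "r * p = g * (r * a)" by (simp add: mult_ac)
  with a(1) assms(1) show ?thesis by (auto intro: subalgebra_mult)
qed

lemma alg_gen_subset: "F \<subseteq> A \<Longrightarrow> alg_gen F \<subseteq> A"
  unfolding alg_gen_def using A by (rule hull_minimal[rotated])

end

lemma is_subalgebra_alg_gen: "is_subalgebra (alg_gen F)"
  unfolding alg_gen_def by (rule hull_in) (auto simp: is_subalgebra_def)

lemma alg_gen_superset: "F \<subseteq> alg_gen F"
  unfolding alg_gen_def by (rule hull_subset)

lemma alg_gen_mono: "F \<subseteq> alg_gen G \<Longrightarrow> alg_gen F \<subseteq> alg_gen G"
  by (rule alg_gen_subset[OF is_subalgebra_alg_gen])

lemma alg_gen_filter_nonconst:
  "alg_gen (set (filter (\<lambda>p. \<not> is_const p) gs)) = alg_gen (set gs)"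
proof (rule antisym)
  show "alg_gen (set (filter (\<lambda>p. \<not> is_const p) gs)) \<subseteq> alg_gen (set gs)"
    using alg_gen_superset[of "set gs"] by (intro alg_gen_mono) auto
  show "alg_gen (set gs) \<subseteq> alg_gen (set (filter (\<lambda>p. \<not> is_const p) gs))"
    using alg_gen_superset[of "set (filter (\<lambda>p. \<not> is_const p) gs)"]
      subalgebra_const[OF is_subalgebra_alg_gen]
    by (intro alg_gen_mono) (auto simp: is_const_def)
qed


section \<open>Substitution is a homomorphism\<close>

lemma monomial_expansion:
  "p = (\<Sum>m \<in> Poly_Mapping.keys p. Poly_Mapping.single m (Poly_Mapping.lookup p m))"
  by (rule poly_mapping_eqI)
     (auto simp: lookup_sum lookup_single when_def in_keys_iff)

lemma substitute_superset:
  assumes "finite M" "Poly_Mapping.keys p \<subseteq> M"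
  shows "substitute f p = (\<Sum>m\<in>M. const_poly (Poly_Mapping.lookup p m) * monom_value f m)"
  unfolding substitute_def using assms
  by (intro sum.mono_neutral_left) (auto simp: in_keys_iff)

lemma substitute_add: "substitute f (p + q) = substitute f p + substitute f q"
proof -
  let ?M = "Poly_Mapping.keys p \<union> Poly_Mapping.keys q"
  have "Poly_Mapping.keys (p + q) \<subseteq> ?M"
    by (rule Poly_Mapping.keys_add)
  then show ?thesis
    by (simp add: substitute_superset[of ?M] lookup_add const_poly_add algebra_simps sum.distrib)
qed

lemma substitute_0 [simp]: "substitute f 0 = 0"
  by (simp add: substitute_def)

lemma substitute_sum: "substitute f (sum h I) = (\<Sum>i\<in>I. substitute f (h i))"
  by (induction I rule: infinite_finite_induct) (simp_all add: substitute_add)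

lemma substitute_single:
  "substitute f (Poly_Mapping.single m c) = const_poly c * monom_value f m"
  by (simp add: substitute_superset[of "{m}"])

lemma monom_value_superset:
  assumes "finite V" "Poly_Mapping.keys m \<subseteq> V"
  shows "monom_value f m = (\<Prod>i\<in>V. f i ^ Poly_Mapping.lookup m i)"
  using assms by (intro prod.mono_neutral_left) (auto simp: in_keys_iff)

lemma monom_value_add: "monom_value f (a + b) = monom_value f a * monom_value f b"
proof -
  let ?V = "Poly_Mapping.keys a \<union> Poly_Mapping.keys b"
  show ?thesis
    by (simp add: monom_value_superset[of ?V] keys_add_nat lookup_add power_add prod.distrib)
qed

lemma substitute_mult: "substitute f (p * q) = substitute f p * substitute f q"
proof -
  let ?c = Poly_Mapping.lookup and ?s = Poly_Mapping.single
  have "p * q = (\<Sum>a\<in>Poly_Mapping.keys p. ?s a (?c p a)) * (\<Sum>b\<in>Poly_Mapping.keys q. ?s b (?c q b))"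
    by (simp only: monomial_expansion[symmetric])
  also have "\<dots> = (\<Sum>a\<in>Poly_Mapping.keys p. \<Sum>b\<in>Poly_Mapping.keys q. ?s (a + b) (?c p a * ?c q b))"
    by (simp add: sum_product mult_single)
  finally have "substitute f (p * q) = (\<Sum>a\<in>Poly_Mapping.keys p. \<Sum>b\<in>Poly_Mapping.keys q.
      (const_poly (?c p a) * monom_value f a) * (const_poly (?c q b) * monom_value f b))"
    by (simp add: substitute_sum substitute_single monom_value_add const_poly_mult mult_ac)
  then show ?thesis
    by (simp add: substitute_def sum_product)
qed

lemma alg_gen_eq_substitute:
  fixes fs :: "'k::field mpoly list"
  shows "alg_gen (set fs) = substitute ((!) fs) ` polys_in {..<length fs}"
proof (rule antisym)
  let ?R = "polys_in {..<length fs} :: 'k mpoly set"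
  have R: "is_subalgebra ?R" by (rule is_subalgebra_polys_in)
  have "is_subalgebra (substitute ((!) fs) ` ?R)"
    unfolding is_subalgebra_def
  proof (intro conjI allI ballI)
    show "const_poly c \<in> substitute ((!) fs) ` ?R" for c
      using subalgebra_const[OF R, of c]
      by (intro image_eqI[where x = "const_poly c"]) (simp_all add: const_poly_def substitute_single)
    show "p + q \<in> substitute ((!) fs) ` ?R"
      if "p \<in> substitute ((!) fs) ` ?R" "q \<in> substitute ((!) fs) ` ?R" for p q
      using that subalgebra_add[OF R] by (auto simp flip: substitute_add)
    show "p * q \<in> substitute ((!) fs) ` ?R"
      if "p \<in> substitute ((!) fs) ` ?R" "q \<in> substitute ((!) fs) ` ?R" for p q
      using that subalgebra_mult[OF R] by (auto simp flip: substitute_mult)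
  qed
  moreover have "set fs \<subseteq> substitute ((!) fs) ` ?R"
  proof
    fix p assume "p \<in> set fs"
    then obtain i where i: "i < length fs" "p = fs ! i"
      by (auto simp: in_set_conv_nth)
    let ?X = "Poly_Mapping.single (Poly_Mapping.single i 1) 1 :: 'k mpoly"
    have "?X \<in> ?R" using i by (simp add: polys_in_def)
    moreover have "substitute ((!) fs) ?X = p"
      using i by (simp add: substitute_single)
    ultimately show "p \<in> substitute ((!) fs) ` ?R" by blast
  qed
  ultimately show "alg_gen (set fs) \<subseteq> substitute ((!) fs) ` ?R"
    by (rule alg_gen_subset)
  show "substitute ((!) fs) ` ?R \<subseteq> alg_gen (set fs)"
    using alg_gen_superset[of "set fs"]
    by (auto intro!: subalgebra_substitute[OF is_subalgebra_alg_gen, where V = "{..<length fs}"])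
qed


section \<open>Leading monomials\<close>

text \<open>
  The exponent vector of the leading monomial with respect to the lexicographic order, under
  which exponent vectors form a linearly ordered cancellative monoid. It is meaningful for
  nonzero polynomials only.
\<close>

definition lead_mon :: "'k::field mpoly \<Rightarrow> (nat \<Rightarrow>\<^sub>0 nat)" where
  "lead_mon p = Max (Poly_Mapping.keys p)"

lemma lead_mon_in_keys: "p \<noteq> 0 \<Longrightarrow> lead_mon p \<in> Poly_Mapping.keys p"
  by (simp add: lead_mon_def)

lemma le_lead_mon: "m \<in> Poly_Mapping.keys p \<Longrightarrow> m \<le> lead_mon p"
  by (simp add: lead_mon_def)

lemma exponent_nonneg: "0 \<le> (m :: nat \<Rightarrow>\<^sub>0 nat)"
proof (rule ccontr)
  assume "\<not> 0 \<le> m"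
  then have "m < 0" by simp
  then have "less_fun (Poly_Mapping.lookup m) (\<lambda>_. 0)"
    by transfer
  then show False by (auto simp: less_fun_def)
qed

lemma pointwise_le_imp_eq_add:
  fixes a m :: "nat \<Rightarrow>\<^sub>0 nat"
  assumes "\<And>i. Poly_Mapping.lookup a i \<le> Poly_Mapping.lookup m i"
  shows "m = (m - a) + a"
  using assms by (intro poly_mapping_eqI) (simp add: lookup_add lookup_minus)

lemma pointwise_le_imp_le:
  fixes a m :: "nat \<Rightarrow>\<^sub>0 nat"
  assumes "\<And>i. Poly_Mapping.lookup a i \<le> Poly_Mapping.lookup m i"
  shows "a \<le> m"
proof -
  have "0 + a \<le> (m - a) + a"
    by (intro add_right_mono exponent_nonneg)
  then show ?thesis
    by (simp only: pointwise_le_imp_eq_add[OF assms, symmetric] add_0_left)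
qed

lemma keys_mult_le:
  fixes p q :: "'k::field mpoly"
  assumes "m \<in> Poly_Mapping.keys (p * q)"
    and "\<And>k. k \<in> Poly_Mapping.keys p \<Longrightarrow> k \<le> a" "\<And>k. k \<in> Poly_Mapping.keys q \<Longrightarrow> k \<le> b"
  shows "m \<le> a + b"
  using assms keys_mult[of p q] by (force intro: add_mono)

lemma lookup_mult_lead_mon:
  fixes p q :: "'k::field mpoly"
  assumes "p \<noteq> 0" "q \<noteq> 0"
  shows "Poly_Mapping.lookup (p * q) (lead_mon p + lead_mon q) =
    Poly_Mapping.lookup p (lead_mon p) * Poly_Mapping.lookup q (lead_mon q)"
proof -
  let ?a = "lead_mon p" and ?b = "lead_mon q"
  define p0 q0 where "p0 = Poly_Mapping.single ?a (Poly_Mapping.lookup p ?a)"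
    and "q0 = Poly_Mapping.single ?b (Poly_Mapping.lookup q ?b)"
  have p': "k < ?a" if "k \<in> Poly_Mapping.keys (p - p0)" for k
    using that le_lead_mon[of k p]
    by (cases "k = ?a") (auto simp: p0_def in_keys_iff lookup_minus lookup_single when_def order_less_le)
  have q': "k < ?b" if "k \<in> Poly_Mapping.keys (q - q0)" for k
    using that le_lead_mon[of k q]
    by (cases "k = ?b") (auto simp: q0_def in_keys_iff lookup_minus lookup_single when_def order_less_le)
  have "?a + ?b \<notin> Poly_Mapping.keys ((p - p0) * q)"
  proof
    assume "?a + ?b \<in> Poly_Mapping.keys ((p - p0) * q)"
    then obtain k l where "?a + ?b = k + l" "k \<in> Poly_Mapping.keys (p - p0)" "l \<in> Poly_Mapping.keys q"
      using keys_mult[of "p - p0" q] by blast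
    then show False
      using add_less_le_mono[OF p' le_lead_mon, of k l q] by simp
  qed
  moreover have "?a + ?b \<notin> Poly_Mapping.keys (p0 * (q - q0))"
  proof
    assume "?a + ?b \<in> Poly_Mapping.keys (p0 * (q - q0))"
    then obtain k l where "?a + ?b = k + l" "k \<in> Poly_Mapping.keys p0" "l \<in> Poly_Mapping.keys (q - q0)"
      using keys_mult[of p0 "q - q0"] by blast
    moreover from this have "k = ?a" by (simp add: p0_def split: if_splits)
    ultimately show False
      using q'[of l] by simp
  qed
  moreover have "p * q = (p - p0) * q + p0 * (q - q0) + p0 * q0"
    by (simp add: algebra_simps)
  ultimately show ?thesis
    by (simp add: lookup_add in_keys_iff p0_def q0_def mult_single)
qed

lemma lead_mon_mult:
  fixes p q :: "'k::field mpoly"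
  assumes "p \<noteq> 0" "q \<noteq> 0"
  shows "lead_mon (p * q) = lead_mon p + lead_mon q"
proof -
  have "lead_mon p + lead_mon q \<in> Poly_Mapping.keys (p * q)"
    using assms lead_mon_in_keys[of p] lead_mon_in_keys[of q]
    by (simp add: in_keys_iff lookup_mult_lead_mon)
  then show ?thesis
    unfolding lead_mon_def[of "p * q"]
    by (intro Max_eqI) (auto intro: keys_mult_le le_lead_mon)
qed

lemma lead_mon_zero_imp_const:
  assumes "lead_mon p = 0"
  shows "is_const p"
proof -
  have "m = 0" if "m \<in> Poly_Mapping.keys p" for m
    using le_lead_mon[OF that] exponent_nonneg[of m] assms by simp
  then have "p = Poly_Mapping.single 0 (Poly_Mapping.lookup p 0)"
    by (intro poly_mapping_eqI) (auto simp: lookup_single when_def in_keys_iff)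
  then show ?thesis
    by (auto simp: is_const_def const_poly_def)
qed


section \<open>Dickson's lemma and the Hilbert basis theorem\<close>

lemma exponent_sequence_monotone_subsequence:
  fixes s :: "nat \<Rightarrow> (nat \<Rightarrow>\<^sub>0 nat)"
  assumes "finite V"
  shows "\<exists>r::nat \<Rightarrow> nat. strict_mono r \<and> (\<forall>v\<in>V. incseq (\<lambda>k. Poly_Mapping.lookup (s (r k)) v))"
  using assms
proof induction
  case empty
  show ?case by (auto intro: strict_mono_id[unfolded id_def])
next
  case (insert v V)
  then obtain r :: "nat \<Rightarrow> nat" where r: "strict_mono r"
    "\<And>w. w \<in> V \<Longrightarrow> incseq (\<lambda>k. Poly_Mapping.lookup (s (r k)) w)"
    by blast
  define x where "x k = Poly_Mapping.lookup (s (r k)) v" for k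
  have "\<exists>t::nat \<Rightarrow> nat. strict_mono t \<and> incseq (\<lambda>k. x (t k))"
  proof -
    obtain t :: "nat \<Rightarrow> nat" where t: "strict_mono t" "monoseq (\<lambda>k. x (t k))"
      using seq_monosub[of x] by blast
    show ?thesis
    proof (cases "incseq (\<lambda>k. x (t k))")
      case True
      with t show ?thesis by blast
    next
      case False
      with t have dec: "decseq (\<lambda>k. x (t k))"
        by (simp add: monoseq_iff)
      \<comment> \<open>A decreasing sequence of naturals is constant from the place where its minimum is attained.\<close>
      obtain N where N: "\<And>k. x (t N) \<le> x (t k)"
        using ex_has_least_nat[of "\<lambda>_. True" 0 "\<lambda>k. x (t k)"] by auto
      have "x (t (N + k)) = x (t N)" for k
        using N[of "N + k"] dec by (simp add: decseq_def order_antisym)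
      then have "incseq (\<lambda>k. x (t (N + k)))"
        by (simp add: incseq_def)
      moreover have "strict_mono (\<lambda>k. t (N + k))"
        using t(1) by (simp add: strict_mono_def)
      ultimately show ?thesis by blast
    qed
  qed
  then obtain t :: "nat \<Rightarrow> nat" where t: "strict_mono t" "incseq (\<lambda>k. x (t k))" by blast
  have "strict_mono (r \<circ> t)"
    using r(1) t(1) by (rule strict_mono_o)
  moreover have "incseq (\<lambda>k. Poly_Mapping.lookup (s ((r \<circ> t) k)) w)" if "w \<in> insert v V" for w
  proof (cases "w = v")
    case True
    with t(2) show ?thesis by (simp add: x_def)
  next
    case False
    with that have "incseq (\<lambda>k. Poly_Mapping.lookup (s (r k)) w)" using r(2) by simp
    then show ?thesis
      using t(1) by (simp add: incseq_def strict_mono_less_eq)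
  qed
  ultimately show ?case by blast
qed

lemma exponent_sequence_good_pair:
  fixes s :: "nat \<Rightarrow> (nat \<Rightarrow>\<^sub>0 nat)"
  assumes "finite V" "\<And>k. Poly_Mapping.keys (s k) \<subseteq> V"
  shows "\<exists>i j. i < j \<and> (\<forall>v. Poly_Mapping.lookup (s i) v \<le> Poly_Mapping.lookup (s j) v)"
proof -
  obtain r :: "nat \<Rightarrow> nat" where r: "strict_mono r"
    "\<And>v. v \<in> V \<Longrightarrow> incseq (\<lambda>k. Poly_Mapping.lookup (s (r k)) v)"
    using exponent_sequence_monotone_subsequence[OF assms(1)] by blast
  have "Poly_Mapping.lookup (s (r 0)) v \<le> Poly_Mapping.lookup (s (r 1)) v" for v
  proof (cases "v \<in> V")
    case True
    from incseqD[OF r(2)[OF this], of 0 1] show ?thesis by simp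
  next
    case False
    with assms(2)[of "r 0"] have "v \<notin> Poly_Mapping.keys (s (r 0))" by blast
    then show ?thesis by (simp add: in_keys_iff)
  qed
  moreover have "r 0 < r 1"
    using r(1) by (simp add: strict_mono_less)
  ultimately show ?thesis by blast
qed

text \<open>
  In finitely many indeterminates the lexicographic order is well-founded: some two terms of
  any sequence are ordered by divisibility, hence lexicographically.
\<close>

lemma wf_exponents:
  assumes "finite V"
  shows "wf {(a, b :: nat \<Rightarrow>\<^sub>0 nat). a < b \<and> Poly_Mapping.keys a \<subseteq> V \<and> Poly_Mapping.keys b \<subseteq> V}"
    (is "wf ?r")
  unfolding wf_iff_no_infinite_down_chain
proof
  assume "\<exists>s. \<forall>i. (s (Suc i), s i) \<in> ?r"
  then obtain s where "\<forall>i. (s (Suc i), s i) \<in> ?r"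
    by blast
  then have s: "s (Suc i) < s i" "Poly_Mapping.keys (s i) \<subseteq> V" for i
    by simp_all
  obtain i j where ij: "i < j" "\<And>v. Poly_Mapping.lookup (s i) v \<le> Poly_Mapping.lookup (s j) v"
    using exponent_sequence_good_pair[of V s, OF assms s(2)] by blast
  have "s j < s i"
    using ij(1) s(1) by (induction rule: less_Suc_induct) auto
  moreover have "s i \<le> s j"
    using ij(2) by (rule pointwise_le_imp_le)
  ultimately show False by simp
qed

text \<open>
  The finite set consists of the elements of \<open>M\<close> that are minimal for divisibility.
  The lexicographic order refines divisibility, so below each element there is a minimal one.
\<close>

lemma Dickson:
  fixes M :: "(nat \<Rightarrow>\<^sub>0 nat) set"
  assumes V: "finite V" and M: "\<And>m. m \<in> M \<Longrightarrow> Poly_Mapping.keys m \<subseteq> V"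
  shows "\<exists>B. finite B \<and> B \<subseteq> M \<and>
    (\<forall>m\<in>M. \<exists>b\<in>B. \<forall>v. Poly_Mapping.lookup b v \<le> Poly_Mapping.lookup m v)"
proof (intro exI conjI ballI)
  let ?dvd = "\<lambda>a b :: nat \<Rightarrow>\<^sub>0 nat. \<forall>v. Poly_Mapping.lookup a v \<le> Poly_Mapping.lookup b v"
  define B where "B = {b \<in> M. \<forall>a\<in>M. ?dvd a b \<longrightarrow> a = b}"
  show "B \<subseteq> M" by (auto simp: B_def)
  show "finite B"
  proof (rule ccontr)
    assume "infinite B"
    then obtain s :: "nat \<Rightarrow> (nat \<Rightarrow>\<^sub>0 nat)" where s: "inj s" "range s \<subseteq> B"
      using infinite_countable_subset by blast
    then have "Poly_Mapping.keys (s k) \<subseteq> V" for k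
      using M \<open>B \<subseteq> M\<close> by blast
    then obtain i j where ij: "i < j" "?dvd (s i) (s j)"
      using exponent_sequence_good_pair[of V s] V by blast
    have "s i \<in> M" "s j \<in> B" using s(2) by (auto simp: B_def)
    then have "s i = s j"
      using ij(2) unfolding B_def by blast
    with s(1) ij(1) show False by (auto dest: injD)
  qed
  fix m assume "m \<in> M"
  with wf_exponents[OF V] show "\<exists>b\<in>B. ?dvd b m"
  proof (induction m rule: wf_induct_rule)
    case (less m)
    show ?case
    proof (cases "m \<in> B")
      case True
      then show ?thesis by blast
    next
      case False
      then obtain a where a: "a \<in> M" "?dvd a m" "a \<noteq> m"
        using less.prems unfolding B_def by blast
      then have "a < m"
        using pointwise_le_imp_le[of a m] by simp
      with a less M obtain b where "b \<in> B" "?dvd b a" by blast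
      with a(2) show ?thesis using order_trans by blast
    qed
  qed
qed

lemma is_ideal_ideal_gen:
  assumes "is_ideal R R" "F \<subseteq> R"
  shows "is_ideal R (ideal_gen R F)"
proof -
  have sub: "ideal_gen R F \<subseteq> R"
    unfolding ideal_gen_def using assms by (intro hull_minimal)
  show ?thesis
    unfolding is_ideal_def
  proof (intro conjI ballI)
    show "ideal_gen R F \<subseteq> R" by (rule sub)
  qed (auto simp: ideal_gen_def hull_def is_ideal_def)
qed

lemma is_ideal_polys_in: "is_ideal (polys_in V) (polys_in V)"
  using is_subalgebra_polys_in[of V] subalgebra_0[OF is_subalgebra_polys_in, of V]
  by (auto simp: is_ideal_def is_subalgebra_def)

text \<open>
  The generators are elements of the ideal whose leading monomials
  generate all leading monomials of the ideal; subtracting a suitable multiple of one of them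
  strictly decreases the leading monomial or gives \<open>0\<close>.
\<close>

theorem Hilbert_basis:
  fixes I :: "'k::field mpoly set"
  assumes V: "finite V" and I: "is_ideal (polys_in V) I"
  shows "\<exists>F. finite F \<and> ideal_gen (polys_in V) F = I"
proof -
  let ?P = "polys_in V :: 'k mpoly set"
  have P: "is_subalgebra ?P" by (rule is_subalgebra_polys_in)
  have IP: "I \<subseteq> ?P" using I by (simp add: is_ideal_def)
  have keysV: "Poly_Mapping.keys (lead_mon p) \<subseteq> V" if "p \<in> ?P" "p \<noteq> 0" for p
    using that lead_mon_in_keys[of p] by (auto simp: polys_in_def)
  have "Poly_Mapping.keys m \<subseteq> V" if "m \<in> lead_mon ` (I - {0})" for m
    using that IP keysV by blast
  from Dickson[of V "lead_mon ` (I - {0})", OF V this]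
  obtain B where B: "finite B" "B \<subseteq> lead_mon ` (I - {0})"
    "\<And>m. m \<in> lead_mon ` (I - {0}) \<Longrightarrow> \<exists>b\<in>B. \<forall>v. Poly_Mapping.lookup b v \<le> Poly_Mapping.lookup m v"
    by blast
  obtain F where F: "finite F" "F \<subseteq> I - {0}" "B = lead_mon ` F"
    using finite_subset_image[OF B(1,2)] by blast
  let ?J = "ideal_gen ?P F"
  have J: "is_ideal ?P ?J"
    using F(2) IP by (intro is_ideal_ideal_gen is_ideal_polys_in) auto
  have FJ: "F \<subseteq> ?J" unfolding ideal_gen_def by (rule hull_subset)
  have JI: "?J \<subseteq> I"
    unfolding ideal_gen_def using F(2) I by (intro hull_minimal) auto
  have "p \<in> ?J" if "p \<in> I" "p \<noteq> 0" "m = lead_mon p" for p m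
    using wf_exponents[OF V] that
  proof (induction m arbitrary: p rule: wf_induct_rule)
    case (less m)
    have pP: "p \<in> ?P" using less.prems IP by blast
    have "m \<in> lead_mon ` (I - {0})" using less.prems by blast
    then obtain b where b: "b \<in> F"
      "\<And>v. Poly_Mapping.lookup (lead_mon b) v \<le> Poly_Mapping.lookup m v"
      using B(3) F(3) by blast
    then have bI: "b \<in> I" "b \<noteq> 0" using F(2) by auto
    define t c where "t = m - lead_mon b"
      and "c = Poly_Mapping.lookup p m / Poly_Mapping.lookup b (lead_mon b)"
    have m: "m = t + lead_mon b"
      unfolding t_def using b(2) by (rule pointwise_le_imp_eq_add)
    let ?X = "Poly_Mapping.single t c :: 'k mpoly"
    have lcb: "Poly_Mapping.lookup b (lead_mon b) \<noteq> 0"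
      using lead_mon_in_keys[OF bI(2)] by (simp add: in_keys_iff)
    have "Poly_Mapping.lookup p m \<noteq> 0"
      using lead_mon_in_keys[OF less.prems(2)] less.prems(3) by (simp add: in_keys_iff)
    then have c: "c \<noteq> 0" using lcb by (simp add: c_def)
    have X: "?X \<noteq> 0" "lead_mon ?X = t"
    proof -
      show "?X \<noteq> 0" using c by (metis lookup_single_eq lookup_zero)
      show "lead_mon ?X = t" using c by (simp add: lead_mon_def)
    qed
    have XP: "?X \<in> ?P"
      using keysV[OF pP less.prems(2)] unfolding less.prems(3)[symmetric] m
      by (auto simp: polys_in_def keys_add_nat)
    define q where "q = p - ?X * b"
    have q0: "q = p + (- ?X) * b" by (simp add: q_def)
    have mX: "- ?X \<in> ?P"
      using XP by (simp add: polys_in_def)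
    have qI: "q \<in> I"
      using I less.prems(1) bI(1) mX unfolding q0 is_ideal_def by blast
    have q_less: "k < m" if k: "k \<in> Poly_Mapping.keys q" for k
    proof -
      have "k \<le> m"
      proof (cases "k \<in> Poly_Mapping.keys p")
        case True
        then show ?thesis using less.prems(3) le_lead_mon by blast
      next
        case False
        with k have "k \<in> Poly_Mapping.keys (?X * b)"
          by (auto simp: q_def in_keys_iff lookup_minus)
        then show ?thesis
          unfolding m by (rule keys_mult_le) (auto intro: le_lead_mon split: if_splits)
      qed
      moreover have "Poly_Mapping.lookup (?X * b) m = Poly_Mapping.lookup p m"
        using lookup_mult_lead_mon[OF X(1) bI(2)] X(2) lcb by (simp add: m c_def)
      then have "Poly_Mapping.lookup q m = 0"
        by (simp add: q_def lookup_minus)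
      with k have "k \<noteq> m" by (auto simp: in_keys_iff)
      ultimately show ?thesis by simp
    qed
    have "q \<in> ?J"
    proof (cases "q = 0")
      case True
      then show ?thesis using J by (simp add: is_ideal_def)
    next
      case False
      have "lead_mon q < m"
        using q_less lead_mon_in_keys[OF False] by blast
      then show ?thesis
        using less.IH[of "lead_mon q" q] qI IP keysV[of q] False keysV[OF pP less.prems(2)] less.prems(3)
        by blast
    qed
    moreover have "?X * b \<in> ?J"
      using J FJ b(1) XP by (auto simp: is_ideal_def)
    ultimately have "q + ?X * b \<in> ?J"
      using J by (simp add: is_ideal_def)
    then show ?case by (simp add: q_def)
  qed
  moreover have "0 \<in> ?J" using J by (simp add: is_ideal_def)
  ultimately have "I \<subseteq> ?J" by blast
  with JI F(1) show ?thesis by blast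
qed


section \<open>Dividing out powers of \<open>g\<close>\<close>

text \<open>
  The exponents \<open>j\<close> with \<open>g^j\<close> dividing \<open>f\<close> are bounded because \<open>j\<close> times the leading exponent vector
  of \<open>g\<close>, which is nonzero, is at most that of \<open>f\<close> in each coordinate.
\<close>

lemma divide_out_spec:
  fixes g f :: "'k::field mpoly"
  assumes f: "f \<in> polys_in {..n}" "f \<noteq> 0" and g: "\<not> is_const g"
  shows "\<exists>i. divide_out n g f \<in> polys_in {..n} \<and> f = g ^ i * divide_out n g f \<and>
    (\<forall>j. (\<exists>q\<in>polys_in {..n}. f = g ^ j * q) \<longrightarrow> j \<le> i)"
proof -
  let ?P = "polys_in {..n} :: 'k mpoly set"
  let ?Q = "\<lambda>i. \<exists>q\<in>?P. f = g ^ i * q"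
  have g0: "g \<noteq> 0" using g by (auto simp: is_const_def intro: const_poly_0[symmetric])
  obtain v where v: "Poly_Mapping.lookup (lead_mon g) v \<noteq> 0"
    using g lead_mon_zero_imp_const[of g] by (metis lookup_zero poly_mapping_eqI)
  have lead_pow: "Poly_Mapping.lookup (lead_mon (g ^ i * q)) v =
      i * Poly_Mapping.lookup (lead_mon g) v + Poly_Mapping.lookup (lead_mon q) v"
    if "q \<noteq> 0" for i q
    using that g0 by (induction i) (simp_all add: mult.assoc lead_mon_mult lookup_add)
  have bound: "i \<le> Poly_Mapping.lookup (lead_mon f) v" if Q: "?Q i" for i
  proof -
    obtain q where q: "f = g ^ i * q" using Q by blast
    with f(2) have "q \<noteq> 0" by auto
    have "i * 1 \<le> i * Poly_Mapping.lookup (lead_mon g) v"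
      using v by (intro mult_le_mono2) linarith
    then show ?thesis
      using lead_pow[OF \<open>q \<noteq> 0\<close>, of i] unfolding q by linarith
  qed
  define i where "i = (GREATEST i. ?Q i)"
  have "?Q 0" using f(1) by simp
  then have Qi: "?Q i"
    unfolding i_def using bound by (rule GreatestI_nat)
  have max: "j \<le> i" if "?Q j" for j
    unfolding i_def using that bound by (rule Greatest_le_nat)
  obtain q where q: "q \<in> ?P" "f = g ^ i * q" using Qi by blast
  have "divide_out n g f = (THE q. q \<in> ?P \<and> f = g ^ i * q)"
    using f(2) g by (simp add: divide_out_def Let_def i_def)
  also have "\<dots> = q"
    using q g0 by (intro the_equality) auto
  finally show ?thesis
    using q max by blast
qed

lemma divide_out_trivial: "f = 0 \<or> is_const g \<Longrightarrow> divide_out n g f = f"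
  unfolding divide_out_def by simp

lemma ideal_gen_principal:
  assumes "g \<in> polys_in V"
  shows "ideal_gen (polys_in V) {g} = (*) g ` polys_in V"
proof (rule antisym)
  let ?P = "polys_in V"
  note P = is_subalgebra_polys_in[of V]
  have "is_ideal ?P ((*) g ` ?P)"
    unfolding is_ideal_def
  proof (intro conjI ballI)
    show "(*) g ` ?P \<subseteq> ?P" using assms subalgebra_mult[OF P] by blast
  qed (auto intro: subalgebra_multiples_0[OF P] subalgebra_multiples_add[OF P]
      subalgebra_multiples_mult[OF P])
  moreover have "{g} \<subseteq> (*) g ` ?P"
    using subalgebra_1[OF P] by (auto intro!: image_eqI[where x = 1])
  ultimately show "ideal_gen ?P {g} \<subseteq> (*) g ` ?P"
    unfolding ideal_gen_def by (intro hull_minimal)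
  have "is_ideal ?P (ideal_gen ?P {g})"
    using assms by (intro is_ideal_ideal_gen is_ideal_polys_in) auto
  moreover have "g \<in> ideal_gen ?P {g}"
    unfolding ideal_gen_def by (rule hull_inc) simp
  ultimately show "(*) g ` ?P \<subseteq> ideal_gen ?P {g}"
    by (auto simp: is_ideal_def mult.commute[of g])
qed

lemma relations_ideal_iff:
  assumes "g \<in> polys_in {..n}"
  shows "H \<in> relations_ideal n g fs \<longleftrightarrow>
    H \<in> polys_in {..<length fs} \<and> substitute ((!) fs) H \<in> (*) g ` polys_in {..n}"
  by (auto simp: relations_ideal_def ideal_gen_principal[OF assms])

lemma relations_ideal_finitely_generated:
  fixes g :: "'k::field mpoly"
  assumes g: "g \<in> polys_in {..n}" and fs: "set fs \<subseteq> polys_in {..n}"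
  shows "\<exists>Hs. ideal_gen (polys_in {..<length fs}) (set Hs) = relations_ideal n g fs"
proof -
  let ?R = "polys_in {..<length fs} :: 'k mpoly set"
  let ?P = "polys_in {..n} :: 'k mpoly set"
  have R: "is_subalgebra ?R" and P: "is_subalgebra ?P" by (rule is_subalgebra_polys_in)+
  have "is_ideal ?R (relations_ideal n g fs)"
    unfolding is_ideal_def
  proof (intro conjI ballI)
    show "relations_ideal n g fs \<subseteq> ?R" by (auto simp: relations_ideal_def)
    show "0 \<in> relations_ideal n g fs"
      using subalgebra_0[OF R] subalgebra_multiples_0[OF P] by (simp add: relations_ideal_iff[OF g])
    show "p + q \<in> relations_ideal n g fs"
      if "p \<in> relations_ideal n g fs" "q \<in> relations_ideal n g fs" for p q
      using that subalgebra_add[OF R] subalgebra_multiples_add[OF P]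
      by (simp add: relations_ideal_iff[OF g] substitute_add)
    show "r * p \<in> relations_ideal n g fs"
      if "r \<in> ?R" "p \<in> relations_ideal n g fs" for r p
    proof -
      have "substitute ((!) fs) r \<in> polys_in {..n}"
        using that(1) fs by (intro subalgebra_substitute[OF P, where V = "{..<length fs}"]) auto
      then show ?thesis
        using that subalgebra_mult[OF R] subalgebra_multiples_mult[OF P]
        by (simp add: relations_ideal_iff[OF g] substitute_mult)
    qed
  qed
  then obtain F where "finite F" "ideal_gen ?R F = relations_ideal n g fs"
    using Hilbert_basis[of "{..<length fs}"] by blast
  then show ?thesis by (metis finite_list)
qed


section \<open>Division by \<open>g\<close> in one iteration\<close>

lemma ideal_gen_eq_imp_subset:
  assumes "ideal_gen R F = I"
  shows "F \<subseteq> I"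
  using assms unfolding ideal_gen_def by (metis hull_subset)

text \<open>
  The engine of the algorithm. A relation modulo \<open>g\<close> is a combination of the \<open>H\<^sub>j\<close>, and each
  \<open>H\<^sub>j(g')\<close> is \<open>g\<close> times an element of any algebra \<open>T\<close> containing \<open>g\<close>, \<open>g'\<close> and \<open>h\<^sub>j\<close>;
  hence division by \<open>g\<close> leads from \<open>K[g']\<close> into \<open>T\<close>.
\<close>

lemma divide_once:
  fixes g :: "'k::field mpoly"
  assumes fs: "set fs \<subseteq> polys_in {..n}" and g: "g \<in> alg_gen (set fs)" "g \<noteq> 0"
    and Hs: "ideal_gen (polys_in {..<length fs}) (set Hs) = relations_ideal n g fs"
    and T: "is_subalgebra T" "set fs \<subseteq> T"
      "\<And>H. H \<in> set Hs \<Longrightarrow> divide_out n g (substitute ((!) fs) H) \<in> T"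
    and f: "f \<in> polys_in {..n}" "g * f \<in> alg_gen (set fs)"
  shows "f \<in> T"
proof -
  let ?R = "polys_in {..<length fs} :: 'k mpoly set"
  let ?s = "substitute ((!) fs)"
  have R: "is_subalgebra ?R" by (rule is_subalgebra_polys_in)
  note P = is_subalgebra_polys_in[of "{..n}"]
  have fsP: "alg_gen (set fs) \<subseteq> polys_in {..n}"
    using fs by (rule alg_gen_subset[OF P])
  have fsT: "alg_gen (set fs) \<subseteq> T"
    using T(2) by (rule alg_gen_subset[OF T(1)])
  have sub: "?s H \<in> alg_gen (set fs)" if "H \<in> ?R" for H
    using that by (auto simp: alg_gen_eq_substitute)
  have gP: "g \<in> polys_in {..n}" and gT: "g \<in> T" using g fsP fsT by auto
  define J where "J = {H \<in> ?R. ?s H \<in> (*) g ` T}"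
  have "is_ideal ?R J"
    unfolding is_ideal_def
  proof (intro conjI ballI)
    show "J \<subseteq> ?R" by (auto simp: J_def)
    show "0 \<in> J" using subalgebra_0[OF R] subalgebra_multiples_0[OF T(1)] by (simp add: J_def)
    show "p + q \<in> J" if "p \<in> J" "q \<in> J" for p q
      using that subalgebra_add[OF R] subalgebra_multiples_add[OF T(1)]
      by (simp add: J_def substitute_add)
    show "r * p \<in> J" if "r \<in> ?R" "p \<in> J" for r p
      using that subalgebra_mult[OF R] subalgebra_multiples_mult[OF T(1)] subsetD[OF fsT sub[OF that(1)]]
      by (simp add: J_def substitute_mult)
  qed
  moreover have "set Hs \<subseteq> J"
  proof
    fix H assume H: "H \<in> set Hs"
    then have "H \<in> relations_ideal n g fs"
      using ideal_gen_eq_imp_subset[OF Hs] by blast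
    then obtain q where HR: "H \<in> ?R" and q: "q \<in> polys_in {..n}" "?s H = g * q"
      by (auto simp: relations_ideal_iff[OF gP])
    have "\<exists>q\<in>T. ?s H = g * q"
    proof (cases "?s H = 0 \<or> is_const g")
      case True
      then show ?thesis
      proof
        assume "?s H = 0"
        then show ?thesis using subalgebra_0[OF T(1)] by auto
      next
        \<comment> \<open>A nonzero constant \<open>g\<close> is invertible, and then its inverse lies in \<open>T\<close> as well.\<close>
        assume "is_const g"
        then obtain c where c: "g = const_poly c" by (auto simp: is_const_def)
        with g(2) have "c \<noteq> 0" by auto
        then have "g * (const_poly (inverse c) * ?s H) = ?s H"
          by (simp add: c flip: mult.assoc const_poly_mult)
        moreover have "const_poly (inverse c) * ?s H \<in> T"
          using sub[OF HR] fsT by (intro subalgebra_mult[OF T(1)] subalgebra_const[OF T(1)]) auto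
        ultimately show ?thesis by metis
      qed
    next
      case False
      let ?d = "divide_out n g (?s H)"
      have "?s H \<in> polys_in {..n}" using sub[OF HR] fsP by blast
      with False obtain i where i: "?s H = g ^ i * ?d"
        "\<And>j. (\<exists>q\<in>polys_in {..n}. ?s H = g ^ j * q) \<Longrightarrow> j \<le> i"
        using divide_out_spec[of "?s H" n g] by blast
      \<comment> \<open>The exponent removed is positive because \<open>H\<close> is a relation modulo \<open>g\<close>.\<close>
      have "1 \<le> i" using q by (intro i(2)) auto
      then have "?s H = g * (g ^ (i - 1) * ?d)"
        using i(1) by (metis One_nat_def Suc_pred' less_eq_Suc_le mult.assoc power_Suc)
      moreover have "g ^ (i - 1) * ?d \<in> T"
        using gT T(3)[OF H] by (intro subalgebra_mult[OF T(1)] subalgebra_power[OF T(1)])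
      ultimately show ?thesis by blast
    qed
    with HR show "H \<in> J" by (auto simp: J_def)
  qed
  ultimately have "relations_ideal n g fs \<subseteq> J"
    unfolding Hs[symmetric] ideal_gen_def by (intro hull_minimal)
  moreover obtain H where H: "H \<in> ?R" "?s H = g * f"
    using f(2) by (auto simp: alg_gen_eq_substitute)
  then have "H \<in> relations_ideal n g fs"
    using f(1) by (auto simp: relations_ideal_iff[OF gP])
  ultimately have "?s H \<in> (*) g ` T"
    unfolding J_def by blast
  then have "g * f \<in> (*) g ` T"
    by (simp only: H(2))
  then show ?thesis using g(2) by auto
qed

section \<open>Saturation\<close>

lemma saturation_iff: "f \<in> saturation n g S \<longleftrightarrow> f \<in> polys_in {..n} \<and> (\<exists>i. g ^ i * f \<in> S)"
  by (auto simp: saturation_def)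

lemma saturation_superset: "S \<subseteq> polys_in {..n} \<Longrightarrow> S \<subseteq> saturation n g S"
  by (force simp: saturation_iff intro: exI[of _ 0])

lemma is_subalgebra_saturation:
  assumes S: "is_subalgebra S" and g: "g \<in> S"
  shows "is_subalgebra (saturation n g S)"
  unfolding is_subalgebra_def
proof (intro conjI allI ballI)
  note P = is_subalgebra_polys_in[of "{..n}"]
  show "const_poly c \<in> saturation n g S" for c
    using subalgebra_const[OF P] subalgebra_const[OF S]
    by (auto simp: saturation_iff intro: exI[of _ 0])
  fix p q assume "p \<in> saturation n g S" "q \<in> saturation n g S"
  then obtain i j where p: "p \<in> polys_in {..n}" "g ^ i * p \<in> S"
    and q: "q \<in> polys_in {..n}" "g ^ j * q \<in> S"
    by (auto simp: saturation_iff)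
  have "g ^ (i + j) * (p + q) = g ^ j * (g ^ i * p) + g ^ i * (g ^ j * q)"
    by (simp add: power_add algebra_simps)
  also have "\<dots> \<in> S"
    using p(2) q(2) g by (blast intro: subalgebra_add[OF S] subalgebra_mult[OF S] subalgebra_power[OF S])
  finally show "p + q \<in> saturation n g S"
    using p(1) q(1) subalgebra_add[OF P] by (auto simp: saturation_iff)
  have "g ^ (i + j) * (p * q) = (g ^ i * p) * (g ^ j * q)"
    by (simp add: power_add algebra_simps)
  also have "\<dots> \<in> S"
    using p(2) q(2) by (rule subalgebra_mult[OF S])
  finally show "p * q \<in> saturation n g S"
    using p(1) q(1) subalgebra_mult[OF P] by (auto simp: saturation_iff)
qed

lemma saturation_divide:
  assumes "f \<in> polys_in {..n}" "g ^ i * f \<in> saturation n g S"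
  shows "f \<in> saturation n g S"
proof -
  obtain j where "g ^ j * (g ^ i * f) \<in> S"
    using assms(2) by (auto simp: saturation_iff)
  then have "g ^ (j + i) * f \<in> S"
    by (simp add: power_add mult.assoc)
  with assms(1) show ?thesis by (auto simp: saturation_iff)
qed

lemma divide_out_in_saturation:
  assumes "f \<in> saturation n g S"
  shows "divide_out n g f \<in> saturation n g S"
proof (cases "f = 0 \<or> is_const g")
  case True
  then show ?thesis using assms by (simp add: divide_out_trivial)
next
  case False
  then obtain i where "divide_out n g f \<in> polys_in {..n}" "f = g ^ i * divide_out n g f"
    using divide_out_spec[of f n g] assms by (auto simp: saturation_iff)
  with assms show ?thesis by (metis saturation_divide)
qed


section \<open>Correctness and termination\<close>

context
  fixes n :: nat and g :: "'k::field mpoly" and S :: "'k mpoly set"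
  assumes S: "is_subalgebra S" "S \<subseteq> polys_in {..n}" and g: "g \<in> S" "g \<noteq> 0"
begin

text \<open>The loop invariant: the current algebra lies between \<open>S\<close> and its saturation.\<close>

definition intermediate :: "'k mpoly list \<Rightarrow> bool" where
  "intermediate gs \<longleftrightarrow> set gs \<subseteq> saturation n g S \<and> S \<subseteq> alg_gen (set gs)"

lemma intermediate_alg_gen_subset: "intermediate gs \<Longrightarrow> alg_gen (set gs) \<subseteq> saturation n g S"
  unfolding intermediate_def using alg_gen_subset[OF is_subalgebra_saturation[OF S(1) g(1)]] by blast

lemma intermediate_filter:
  "intermediate gs \<Longrightarrow> intermediate (filter (\<lambda>p. \<not> is_const p) gs)"
  using alg_gen_filter_nonconst[of gs] by (auto simp: intermediate_def)

lemma intermediate_polys: "intermediate gs \<Longrightarrow> set gs \<subseteq> polys_in {..n}"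
  by (auto simp: intermediate_def saturation_iff)

lemma iteration_in_saturation:
  assumes gs: "intermediate gs"
    and Hs: "ideal_gen (polys_in {..<length gs}) (set Hs) = relations_ideal n g gs"
  shows "set (map (\<lambda>H. divide_out n g (substitute ((!) gs) H)) Hs) \<subseteq> saturation n g S"
proof -
  have "substitute ((!) gs) H \<in> saturation n g S" if "H \<in> set Hs" for H
  proof -
    have "H \<in> polys_in {..<length gs}"
      using ideal_gen_eq_imp_subset[OF Hs] that by (auto simp: relations_ideal_def)
    then have "substitute ((!) gs) H \<in> alg_gen (set gs)"
      by (auto simp: alg_gen_eq_substitute)
    then show ?thesis using intermediate_alg_gen_subset[OF gs] by blast
  qed
  then show ?thesis by (auto intro: divide_out_in_saturation)
qed

lemma loop_step_progress:
  assumes "intermediate gs"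
  shows "\<exists>s. loop_step n g (Running gs) s"
proof -
  define gs' where "gs' = filter (\<lambda>p. \<not> is_const p) gs"
  have "set gs' \<subseteq> polys_in {..n}"
    using intermediate_polys[OF intermediate_filter[OF assms]] by (simp add: gs'_def)
  moreover have "g \<in> polys_in {..n}" using g S by blast
  ultimately obtain Hs where Hs:
    "ideal_gen (polys_in {..<length gs'}) (set Hs) = relations_ideal n g gs'"
    using relations_ideal_finitely_generated by blast
  show ?thesis
    using loop_step.stop[OF gs'_def Hs refl] loop_step.continue[OF gs'_def Hs refl] by blast
qed

lemma loop_step_continue:
  assumes step: "loop_step n g (Running gs) (Running gs2)" and gs: "intermediate gs"
  shows "intermediate gs2"
    and "\<And>f. f \<in> polys_in {..n} \<Longrightarrow> g * f \<in> alg_gen (set gs) \<Longrightarrow> f \<in> alg_gen (set gs2)"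
    and "alg_gen (set gs) \<noteq> saturation n g S"
proof -
  from step obtain gs' hs Hs where gs': "gs' = filter (\<lambda>p. \<not> is_const p) gs"
    and Hs: "ideal_gen (polys_in {..<length gs'}) (set Hs) = relations_ideal n g gs'"
    and hs: "hs = map (\<lambda>H. divide_out n g (substitute ((!) gs') H)) Hs"
    and new: "\<not> set hs \<subseteq> alg_gen (set gs)" and gs2: "gs2 = gs' @ hs"
    by (cases rule: loop_step.cases) auto
  have inter': "intermediate gs'" using gs gs' intermediate_filter by blast
  have gen': "alg_gen (set gs') = alg_gen (set gs)"
    unfolding gs' by (rule alg_gen_filter_nonconst)
  have sat: "set hs \<subseteq> saturation n g S"
    unfolding hs by (rule iteration_in_saturation[OF inter' Hs])
  have "alg_gen (set gs') \<subseteq> alg_gen (set gs2)"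
    using alg_gen_superset[of "set gs2"] by (intro alg_gen_mono) (simp add: gs2)
  with sat inter' show "intermediate gs2"
    by (auto simp: intermediate_def gs2)
  show "alg_gen (set gs) \<noteq> saturation n g S"
    using sat new by blast
  have g': "g \<in> alg_gen (set gs')"
    using inter' g(1) by (auto simp: intermediate_def)
  show "f \<in> alg_gen (set gs2)" if "f \<in> polys_in {..n}" "g * f \<in> alg_gen (set gs)" for f
  proof (rule divide_once[OF intermediate_polys[OF inter'] g' g(2) Hs is_subalgebra_alg_gen])
    show "set gs' \<subseteq> alg_gen (set gs2)"
      using alg_gen_superset[of "set gs2"] by (simp add: gs2)
    show "divide_out n g (substitute ((!) gs') H) \<in> alg_gen (set gs2)" if "H \<in> set Hs" for H
      using that alg_gen_superset[of "set gs2"] by (auto simp: gs2 hs)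
  qed (use that gen' in auto)
qed

lemma loop_step_return:
  assumes step: "loop_step n g (Running gs) (Returned T)" and gs: "intermediate gs"
  shows "T = saturation n g S"
proof -
  from step obtain gs' hs Hs where gs': "gs' = filter (\<lambda>p. \<not> is_const p) gs"
    and Hs: "ideal_gen (polys_in {..<length gs'}) (set Hs) = relations_ideal n g gs'"
    and hs: "hs = map (\<lambda>H. divide_out n g (substitute ((!) gs') H)) Hs"
    and old: "set hs \<subseteq> alg_gen (set gs)" and T: "T = alg_gen (set gs)"
    by (cases rule: loop_step.cases) auto
  have inter': "intermediate gs'" using gs gs' intermediate_filter by blast
  have T': "T = alg_gen (set gs')"
    unfolding T gs' by (rule alg_gen_filter_nonconst[symmetric])
  have gT: "g \<in> alg_gen (set gs')"
    using inter' g(1) by (auto simp: intermediate_def)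
  have div: "f \<in> T" if "f \<in> polys_in {..n}" "g * f \<in> T" for f
  proof (rule divide_once[OF intermediate_polys[OF inter'] gT g(2) Hs])
    show "is_subalgebra T" unfolding T by (rule is_subalgebra_alg_gen)
    show "set gs' \<subseteq> T" unfolding T' by (rule alg_gen_superset)
    show "divide_out n g (substitute ((!) gs') H) \<in> T" if "H \<in> set Hs" for H
      using that old by (auto simp: T hs)
  qed (use that T' in auto)
  have "f \<in> T" if "f \<in> polys_in {..n}" "g ^ i * f \<in> T" for f i
    using that
  proof (induction i arbitrary: f)
    case (Suc i)
    have "g * f \<in> polys_in {..n}"
      using Suc.prems(1) g(1) S(2) by (intro subalgebra_mult[OF is_subalgebra_polys_in]) auto
    with Suc have "g * f \<in> T" by (simp add: mult_ac)
    with Suc.prems(1) show ?case by (rule div)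
  qed simp
  moreover have "S \<subseteq> T"
    using gs unfolding T by (simp add: intermediate_def)
  ultimately have "saturation n g S \<subseteq> T"
    unfolding saturation_iff subset_iff by blast
  with intermediate_alg_gen_subset[OF gs] T show ?thesis by blast
qed

lemma intermediate_reachable:
  assumes "(loop_step n g)\<^sup>*\<^sup>* (Running gs) s" "intermediate gs"
  shows "case s of Running gs' \<Rightarrow> intermediate gs' | Returned T \<Rightarrow> T = saturation n g S"
  using assms
proof (induction rule: rtranclp_induct)
  case (step s t)
  show ?case
  proof (cases s)
    case (Running gs')
    with step have "intermediate gs'" by simp
    with step.hyps(2) Running show ?thesis
      by (cases t) (auto dest: loop_step_continue(1) loop_step_return)
  next
    case (Returned T)
    with step.hyps(2) show ?thesis by (auto elim: loop_step.cases)
  qed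
qed simp

lemma no_infinite_run:
  assumes fg: "finitely_generated_alg (saturation n g S)"
    and gs: "intermediate (\<gamma> 0)"
    and step: "\<And>k. loop_step n g (Running (\<gamma> k)) (Running (\<gamma> (Suc k)))"
  shows False
proof -
  have inter: "intermediate (\<gamma> k)" for k
    by (induction k) (use gs step loop_step_continue(1) in blast)+
  \<comment> \<open>Each iteration gains one division by \<open>g\<close>.\<close>
  have shift: "f \<in> alg_gen (set (\<gamma> (k + i)))"
    if "f \<in> polys_in {..n}" "g ^ i * f \<in> alg_gen (set (\<gamma> k))" for f i k
    using that
  proof (induction i arbitrary: f)
    case (Suc i)
    have "g * f \<in> polys_in {..n}"
      using Suc.prems(1) g(1) S(2) by (intro subalgebra_mult[OF is_subalgebra_polys_in]) auto
    with Suc have "g * f \<in> alg_gen (set (\<gamma> (k + i)))" by (simp add: mult_ac)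
    with loop_step_continue(2)[OF step inter] Suc.prems(1) show ?case by simp
  qed simp
  obtain F where F: "finite F" "saturation n g S = alg_gen F"
    using fg by (auto simp: finitely_generated_alg_def)
  have Fsat: "F \<subseteq> saturation n g S" using F(2) alg_gen_superset by blast
  then have "\<exists>i. \<forall>f\<in>F. g ^ (i f) * f \<in> S"
    by (intro bchoice) (auto simp: saturation_iff)
  then obtain i where i: "\<And>f. f \<in> F \<Longrightarrow> g ^ (i f) * f \<in> S" by blast
  define N where "N = Max (insert 0 (i ` F))"
  have "F \<subseteq> alg_gen (set (\<gamma> N))"
  proof
    fix f assume f: "f \<in> F"
    then have le: "i f \<le> N" using F(1) by (simp add: N_def)
    have "g ^ N * f = g ^ (N - i f) * (g ^ (i f) * f)"
      using le by (simp flip: mult.assoc power_add)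
    also have "\<dots> \<in> S"
      using i[OF f] g(1) by (blast intro: subalgebra_mult[OF S(1)] subalgebra_power[OF S(1)])
    finally have "g ^ N * f \<in> alg_gen (set (\<gamma> 0))"
      using gs by (auto simp: intermediate_def)
    then show "f \<in> alg_gen (set (\<gamma> N))"
      using shift[of f N 0] f Fsat by (auto simp: saturation_iff)
  qed
  then have "saturation n g S \<subseteq> alg_gen (set (\<gamma> N))"
    unfolding F(2) by (rule alg_gen_mono)
  with intermediate_alg_gen_subset[OF inter[of N]] loop_step_continue(3)[OF step inter, of N]
  show False by blast
qed

end

theorem mainTheorem5:
  fixes n :: nat
    and gs :: "'k::field mpoly list"
    and S :: "'k mpoly set"
    and g :: "'k mpoly"
  assumes "set gs \<subseteq> polys_in {..n}"
    and "S = alg_gen (set gs)"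
    and "g \<in> S - {0}"
    and "finitely_generated_alg (saturation n g S)"
  shows "\<not> (\<exists>\<sigma> :: nat \<Rightarrow> 'k mpoly state.
              \<sigma> 0 = Running gs \<and> (\<forall>k. loop_step n g (\<sigma> k) (\<sigma> (Suc k))))
       \<and> (\<forall>gs'. (loop_step n g)\<^sup>*\<^sup>* (Running gs) (Running gs') \<longrightarrow>
              (\<exists>s. loop_step n g (Running gs') s))
       \<and> (\<forall>T. (loop_step n g)\<^sup>*\<^sup>* (Running gs) (Returned T) \<longrightarrow> T = saturation n g S)"
proof -
  have S: "is_subalgebra S" "S \<subseteq> polys_in {..n}"
    using is_subalgebra_alg_gen alg_gen_subset[OF is_subalgebra_polys_in assms(1)]
    by (simp_all add: assms(2))
  have g: "g \<in> S" "g \<noteq> 0" using assms(3) by auto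
  have init: "intermediate n g S gs"
    using saturation_superset[OF S(2), of g] alg_gen_superset[of "set gs"] assms(2)
    by (auto simp: intermediate_def[OF S[unfolded assms(2)] g[unfolded assms(2)]])
  note reach = intermediate_reachable[OF S g _ init]
  have "False" if \<sigma>: "\<sigma> 0 = Running gs" "\<And>k. loop_step n g (\<sigma> k) (\<sigma> (Suc k))"
    for \<sigma> :: "nat \<Rightarrow> 'k mpoly state"
  proof -
    \<comment> \<open>No step leaves a \<open>Returned\<close> state, so all states of an infinite run are \<open>Running\<close>.\<close>
    have "\<exists>hs. \<sigma> k = Running hs" for k
      using \<sigma>(2)[of k] by (auto elim: loop_step.cases)
    then obtain \<gamma> where \<gamma>: "\<And>k. \<sigma> k = Running (\<gamma> k)" by metis
    show False
      using no_infinite_run[OF S g assms(4), of \<gamma>] \<sigma> init \<gamma> by simp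
  qed
  moreover have "\<exists>s. loop_step n g (Running gs') s"
    if "(loop_step n g)\<^sup>*\<^sup>* (Running gs) (Running gs')" for gs'
    using reach[OF that] loop_step_progress[OF S g] by simp
  moreover have "T = saturation n g S" if "(loop_step n g)\<^sup>*\<^sup>* (Running gs) (Returned T)" for T
    using reach[OF that] by simp
  ultimately show ?thesis by blast
qed

end
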